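(* Let $G=(V,E)$ be a finite connected graph (parallel edges allowed, no loops) with at least two vertices. Let $F$ be a two-forest of $G$ chosen uniformly at random among all two-forests of $G$, and let $\partial F$ be its cut set. Then \[ \mathbb{E}(|\partial F|) \;\leq\; 2\,(\mathrm{avg.deg})\left(1+\frac{1}{|V|-1}\right), \] where $\mathrm{avg.deg} = \frac{1}{|V|}\sum_{v\in V}\deg v = 2|E|/|V|$ is the average degree of $G$.
   Context: A two-forest of $G$ is a spanning subgraph with no cycles having exactly two connected components. If the components of a two-forest $F$ have vertex sets $A$ and $B$ (so $V=A\sqcup B$), the cut set $\partial F$ is the set of edges of $G$ with one endpoint in $A$ and the other in $B$. *)

theory Defs
  imports "HOL-Probability.Probability"
begin

text \<open>
  Undirected multigraphs: edges are abstract objects, each carrying its set of end vertices, so that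
  distinct edges may have the same ends. Loops are excluded by requiring exactly two ends.
\<close>

record ('v, 'e) multigraph =
  verts :: "'v set"
  edges :: "'e set"
  ends :: "'e \<Rightarrow> 'v set"

definition finite_multigraph :: "('v, 'e) multigraph \<Rightarrow> bool" where
  "finite_multigraph G \<longleftrightarrow> finite (verts G) \<and> finite (edges G) \<and>
     (\<forall>e\<in>edges G. ends G e \<subseteq> verts G \<and> card (ends G e) = 2)"

definition adjacency :: "('v, 'e) multigraph \<Rightarrow> ('v \<times> 'v) set" where
  "adjacency G = {(u, v). \<exists>e\<in>edges G. ends G e = {u, v}}"

definition graph_components :: "('v, 'e) multigraph \<Rightarrow> 'v set set" where
  "graph_components G = (\<lambda>v. {u \<in> verts G. (v, u) \<in> (adjacency G)\<^sup>*}) ` verts G"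

definition connected_graph :: "('v, 'e) multigraph \<Rightarrow> bool" where
  "connected_graph G \<longleftrightarrow> (\<forall>u\<in>verts G. \<forall>v\<in>verts G. (u, v) \<in> (adjacency G)\<^sup>*)"

text \<open>
  A cycle is given by its distinct vertices and distinct edges in cyclic order, edge number \<open>i\<close> joining
  vertex number \<open>i\<close> to the next one. Two parallel edges form a cycle of length 2.
\<close>

definition is_cycle :: "('v, 'e) multigraph \<Rightarrow> 'v list \<Rightarrow> 'e list \<Rightarrow> bool" where
  "is_cycle G vs es \<longleftrightarrow> es \<noteq> [] \<and> length vs = length es \<and> distinct vs \<and> distinct es \<and>
     set vs \<subseteq> verts G \<and> set es \<subseteq> edges G \<and>
     (\<forall>i<length es. ends G (es ! i) = {vs ! i, vs ! (Suc i mod length es)})"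

definition acyclic_graph :: "('v, 'e) multigraph \<Rightarrow> bool" where
  "acyclic_graph G \<longleftrightarrow> (\<nexists>vs es. is_cycle G vs es)"

text \<open>A spanning subgraph of \<open>G\<close> is identified with its edge set.\<close>

definition spanning_subgraph :: "('v, 'e) multigraph \<Rightarrow> 'e set \<Rightarrow> ('v, 'e) multigraph" where
  "spanning_subgraph G F = G\<lparr>edges := F\<rparr>"

definition two_forests :: "('v, 'e) multigraph \<Rightarrow> 'e set set" where
  "two_forests G = {F. F \<subseteq> edges G \<and> acyclic_graph (spanning_subgraph G F) \<and>
     card (graph_components (spanning_subgraph G F)) = 2}"

definition cut_set :: "('v, 'e) multigraph \<Rightarrow> 'e set \<Rightarrow> 'e set" where
  "cut_set G F = {e \<in> edges G. \<exists>A \<in> graph_components (spanning_subgraph G F).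
     \<exists>B \<in> graph_components (spanning_subgraph G F).
       A \<noteq> B \<and> (\<exists>a\<in>A. \<exists>b\<in>B. ends G e = {a, b})}"

definition degree :: "('v, 'e) multigraph \<Rightarrow> 'v \<Rightarrow> nat" where
  "degree G v = card {e \<in> edges G. v \<in> ends G e}"

definition avg_deg :: "('v, 'e) multigraph \<Rightarrow> real" where
  "avg_deg G = (\<Sum>v\<in>verts G. real (degree G v)) / real (card (verts G))"

lemma avg_deg_eq:
  assumes "finite_multigraph G"
  shows "avg_deg G = 2 * real (card (edges G)) / real (card (verts G))"
proof -
  have fin: "finite (verts G)" "finite (edges G)"
    using assms by (auto simp: finite_multigraph_def)
  have "(\<Sum>v\<in>verts G. degree G v) = (\<Sum>v\<in>verts G. \<Sum>e\<in>edges G. if v \<in> ends G e then 1 else 0)"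
    by (simp add: degree_def fin sum.If_cases Int_def)
  also have "\<dots> = (\<Sum>e\<in>edges G. \<Sum>v\<in>verts G. if v \<in> ends G e then 1 else 0)"
    by (rule sum.swap)
  also have "\<dots> = (\<Sum>e\<in>edges G. card (verts G \<inter> ends G e))"
    by (simp add: fin sum.If_cases Int_def)
  also have "\<dots> = (\<Sum>e\<in>edges G. 2)"
    using assms by (intro sum.cong) (auto simp: finite_multigraph_def Int_absorb1)
  finally have "(\<Sum>v\<in>verts G. degree G v) = 2 * card (edges G)"
    by simp
  then have "(\<Sum>v\<in>verts G. real (degree G v)) = 2 * real (card (edges G))"
    by (metis of_nat_mult of_nat_numeral of_nat_sum)
  then show ?thesis
    by (simp add: avg_deg_def)
qed

end

theory Submission
  imports Defs
begin

text \<open>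
  Write \<open>\<kappa>\<close> for the number of spanning trees, \<open>\<kappa>\<^sub>2\<close> for the number of two-forests and \<open>R e\<close> for the
  number of two-forests separating the ends of \<open>e\<close>, which is also the number of spanning trees
  through \<open>e\<close>. Counting trees by edges, the cut sizes sum to \<open>\<Sum>e. R e = (|V| - 1) \<kappa>\<close>, so by
  Cauchy--Schwarz it suffices that \<open>4 \<kappa> \<kappa>\<^sub>2 \<ge> \<Sum>e. (R e)\<^sup>2\<close>.

  Fix a vertex \<open>q\<close> and let \<open>g x y\<close> be the number of two-forests in which \<open>x\<close> and \<open>y\<close> lie together away
  from \<open>q\<close>; put \<open>h x = g x x\<close>. Along an edge, \<open>g x\<close> changes by the net number of spanning trees whose
  path from \<open>x\<close> to \<open>q\<close> uses that edge. Since each such path is a unit flow, \<open>g / \<kappa>\<close> is the Green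
  function of the Laplacian grounded at \<open>q\<close>.

  In a two-forest the tree avoiding \<open>q\<close> has one vertex more than edges, so
  \<open>\<kappa>\<^sub>2 = \<Sum>v. h v - \<Sum>e. N e\<close>, where \<open>N e\<close> counts the two-forests having the edge \<open>e\<close> in that tree.
  Grounding a second vertex gives \<open>\<kappa> N e = h u h w - (g u w)\<^sup>2\<close> for \<open>e = uw\<close>. As
  \<open>R e = h u + h w - 2 g u w\<close>, summation by parts yields the identity
  \<open>\<kappa> \<kappa>\<^sub>2 = \<Sum>e. (R e)\<^sup>2 / 4 + 3 / 4 (h u - h w)\<^sup>2\<close>.
\<close>

lemma card_Collect_split:
  assumes "finite A"
  shows "card {a \<in> A. P a} = card {a \<in> A. P a \<and> Q a} + card {a \<in> A. P a \<and> \<not> Q a}"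
proof -
  have "card {a \<in> A. P a} = card ({a \<in> A. P a} \<inter> Collect Q) + card ({a \<in> A. P a} - Collect Q)"
    using assms by (intro card_Int_Diff) simp
  also have "{a \<in> A. P a} \<inter> Collect Q = {a \<in> A. P a \<and> Q a}"
    by auto
  also have "{a \<in> A. P a} - Collect Q = {a \<in> A. P a \<and> \<not> Q a}"
    by auto
  finally show ?thesis .
qed

lemma card_image_eq_2_iff:
  "card (f ` A) = 2 \<longleftrightarrow>
    (\<exists>a\<in>A. \<exists>b\<in>A. f a \<noteq> f b \<and> (\<forall>c\<in>A. f c = f a \<or> f c = f b))"
proof
  assume "card (f ` A) = 2"
  then obtain x y where xy: "f ` A = {x, y}" "x \<noteq> y"
    by (auto simp: card_2_iff)
  then obtain a b where "a \<in> A" "b \<in> A" "x = f a" "y = f b"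
    by (metis imageE insertI1 insertI2)
  with xy show "\<exists>a\<in>A. \<exists>b\<in>A. f a \<noteq> f b \<and> (\<forall>c\<in>A. f c = f a \<or> f c = f b)"
    by blast
next
  assume "\<exists>a\<in>A. \<exists>b\<in>A. f a \<noteq> f b \<and> (\<forall>c\<in>A. f c = f a \<or> f c = f b)"
  then obtain a b where "f ` A = {f a, f b}" "f a \<noteq> f b"
    by blast
  then show "card (f ` A) = 2"
    by (auto simp: card_2_iff)
qed

lemma spanning_subgraph_simps [simp]:
  "verts (spanning_subgraph G F) = verts G"
  "edges (spanning_subgraph G F) = F"
  "ends (spanning_subgraph G F) = ends G"
  by (simp_all add: spanning_subgraph_def)

lemma spanning_subgraph_edges: "spanning_subgraph G (edges G) = G"
  by (simp add: spanning_subgraph_def)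

locale fin_multigraph =
  fixes G :: "('v, 'e) multigraph"
  assumes finite_multigraph: "finite_multigraph G"
begin

abbreviation V :: "'v set" where "V \<equiv> verts G"

abbreviation E :: "'e set" where "E \<equiv> edges G"

lemma finite_verts: "finite V" and finite_edges: "finite E"
  using finite_multigraph by (auto simp: finite_multigraph_def)

lemma ends_subset_verts: "e \<in> E \<Longrightarrow> ends G e \<subseteq> V"
  using finite_multigraph by (auto simp: finite_multigraph_def)

lemma card_ends: "e \<in> E \<Longrightarrow> card (ends G e) = 2"
  using finite_multigraph by (auto simp: finite_multigraph_def)

definition other :: "'e \<Rightarrow> 'v \<Rightarrow> 'v" where
  "other e x = the_elem (ends G e - {x})"

definition tail :: "'e \<Rightarrow> 'v" where
  "tail e = (SOME x. x \<in> ends G e)"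

definition head :: "'e \<Rightarrow> 'v" where
  "head e = other e (tail e)"

lemma other_tail [simp]: "other e (tail e) = head e"
  by (simp add: head_def)

lemma other_eq:
  assumes "e \<in> E" "ends G e = {x, y}"
  shows "other e x = y"
proof -
  have "x \<noteq> y"
    using card_ends[OF assms(1)] assms(2) by auto
  then have "ends G e - {x} = {y}"
    using assms(2) by auto
  then show ?thesis
    by (simp add: other_def)
qed

lemma ends_other:
  assumes "e \<in> E" "x \<in> ends G e"
  shows "ends G e = {x, other e x}"
proof -
  obtain y z where "ends G e = {y, z}"
    using card_ends[OF assms(1)] by (auto simp: card_2_iff)
  moreover from this have "x = y \<or> x = z"
    using assms(2) by simp
  ultimately obtain y where "ends G e = {x, y}"
    by (metis insert_commute)
  then show ?thesis
    using other_eq[OF assms(1)] by simp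
qed

lemma ends_tail_head: "e \<in> E \<Longrightarrow> ends G e = {tail e, head e}"
proof -
  assume e: "e \<in> E"
  then have "ends G e \<noteq> {}"
    using card_ends by fastforce
  then have "tail e \<in> ends G e"
    unfolding tail_def by (rule some_in_eq[THEN iffD2])
  then show ?thesis
    using ends_other[OF e] unfolding head_def by blast
qed

lemma other_head [simp]: "e \<in> E \<Longrightarrow> other e (head e) = tail e"
  using ends_tail_head by (intro other_eq) auto

lemma tail_in_verts: "e \<in> E \<Longrightarrow> tail e \<in> V"
  and head_in_verts: "e \<in> E \<Longrightarrow> head e \<in> V"
  using ends_subset_verts ends_tail_head by blast+

lemma tail_neq_head: "e \<in> E \<Longrightarrow> tail e \<noteq> head e"
  using card_ends ends_tail_head by fastforce

definition incident :: "'v \<Rightarrow> 'e set" where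
  "incident x = {e \<in> E. x \<in> ends G e}"

lemma finite_incident: "finite (incident x)"
  using finite_edges by (simp add: incident_def)

lemma ends_incident: "e \<in> incident x \<Longrightarrow> ends G e = {x, other e x}"
  by (simp add: incident_def ends_other)

lemma sum_incident:
  fixes \<phi> :: "'v \<Rightarrow> 'e \<Rightarrow> 'a::comm_monoid_add"
  shows "(\<Sum>x\<in>V. \<Sum>e\<in>incident x. \<phi> x e) = (\<Sum>e\<in>E. \<phi> (tail e) e + \<phi> (head e) e)"
proof -
  have "(\<Sum>x\<in>V. \<Sum>e\<in>incident x. \<phi> x e) = (\<Sum>e\<in>E. \<Sum>x\<in>{x \<in> V. x \<in> ends G e}. \<phi> x e)"
    unfolding incident_def by (rule sum.swap_restrict[OF finite_verts finite_edges])
  also have "\<dots> = (\<Sum>e\<in>E. \<phi> (tail e) e + \<phi> (head e) e)"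
  proof (rule sum.cong[OF refl])
    fix e assume e: "e \<in> E"
    then have "{x \<in> V. x \<in> ends G e} = {tail e, head e}"
      using ends_subset_verts ends_tail_head by auto
    then show "(\<Sum>x\<in>{x \<in> V. x \<in> ends G e}. \<phi> x e) = \<phi> (tail e) e + \<phi> (head e) e"
      using tail_neq_head[OF e] by simp
  qed
  finally show ?thesis .
qed

section \<open>Connectivity by a set of edges\<close>

definition conn :: "'e set \<Rightarrow> 'v \<Rightarrow> 'v \<Rightarrow> bool" where
  "conn F x y \<longleftrightarrow> (x, y) \<in> (adjacency (spanning_subgraph G F))\<^sup>*"

definition component :: "'e set \<Rightarrow> 'v \<Rightarrow> 'v set" where
  "component F x = {v \<in> V. conn F x v}"

lemma adjacency_spanning_subgraph:
  "adjacency (spanning_subgraph G F) = {(x, y). \<exists>e\<in>F. ends G e = {x, y}}"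
  by (simp add: adjacency_def)

lemma conn_refl [simp]: "conn F x x"
  by (simp add: conn_def)

lemma conn_trans: "conn F x y \<Longrightarrow> conn F y z \<Longrightarrow> conn F x z"
  unfolding conn_def by (rule rtrancl_trans)

lemma conn_sym: "conn F x y \<Longrightarrow> conn F y x"
  unfolding conn_def
  by (rule symD[OF sym_rtrancl]) (auto simp: sym_def adjacency_spanning_subgraph insert_commute)

lemma conn_commute: "conn F x y \<longleftrightarrow> conn F y x"
  by (blast intro: conn_sym)

lemma conn_cong: "conn F x y \<Longrightarrow> conn F x z \<longleftrightarrow> conn F y z"
  by (blast intro: conn_sym conn_trans)

lemma conn_edge: "e \<in> F \<Longrightarrow> ends G e = {x, y} \<Longrightarrow> conn F x y"
  unfolding conn_def adjacency_spanning_subgraph by (rule r_into_rtrancl) auto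

lemma conn_tail_head: "e \<in> F \<Longrightarrow> e \<in> E \<Longrightarrow> conn F (tail e) (head e)"
  using conn_edge ends_tail_head by blast

lemma conn_mono: "conn F x y \<Longrightarrow> F \<subseteq> F' \<Longrightarrow> conn F' x y"
  unfolding conn_def adjacency_spanning_subgraph
  by (erule rtrancl_mono[THEN subsetD, rotated]) auto

lemma conn_induct [consumes 1, case_names refl step]:
  assumes "conn F x y" "P x"
    and "\<And>y z e. conn F x y \<Longrightarrow> P y \<Longrightarrow> e \<in> F \<Longrightarrow> ends G e = {y, z} \<Longrightarrow> P z"
  shows "P y"
  using assms(1) unfolding conn_def
  by (induction rule: rtrancl_induct)
    (auto intro: assms(2) assms(3) simp: conn_def adjacency_spanning_subgraph)

lemma conn_insert:
  assumes "ends G e = {x, y}"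
  shows "conn (insert e F) a b \<longleftrightarrow>
    conn F a b \<or> conn F a x \<and> conn F y b \<or> conn F a y \<and> conn F x b" (is "_ \<longleftrightarrow> ?R b")
proof
  assume "conn (insert e F) a b"
  then show "?R b"
  proof (induction rule: conn_induct)
    case (step c d f)
    show ?case
    proof (cases "f \<in> F")
      case True
      then have "conn F c d"
        using step.hyps(3) by (rule conn_edge)
      then show ?thesis
        using step.IH by (blast intro: conn_trans)
    next
      case False
      then have "c = x \<and> d = y \<or> c = y \<and> d = x"
        using step.hyps assms by (auto simp: doubleton_eq_iff)
      then show ?thesis
        using step.IH by (auto intro: conn_sym conn_trans)
    qed
  qed simp
next
  have "conn (insert e F) x y"
    by (rule conn_edge[OF _ assms]) simp
  moreover have "conn (insert e F) u v" if "conn F u v" for u v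
    using that by (rule conn_mono) auto
  moreover assume "?R b"
  ultimately show "conn (insert e F) a b"
    by (meson conn_sym conn_trans)
qed

lemma component_eq_iff:
  assumes "x \<in> V" "y \<in> V"
  shows "component F x = component F y \<longleftrightarrow> conn F x y"
  using assms conn_cong unfolding component_def by (auto intro: conn_sym)

lemma ends_subset_component:
  assumes "F \<subseteq> E" "e \<in> F" "x \<in> ends G e" "x \<in> component F a"
  shows "ends G e \<subseteq> component F a"
proof -
  have e: "e \<in> E"
    using assms(1,2) by blast
  have ends: "ends G e = {x, other e x}"
    using e assms(3) by (rule ends_other)
  have "other e x \<in> V"
    using ends_subset_verts[OF e] unfolding ends by simp
  moreover have "conn F x (other e x)"
    using assms(2) ends by (rule conn_edge)
  ultimately show ?thesis
    unfolding ends using assms(4) by (auto simp: component_def intro: conn_trans)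
qed

lemma graph_components_eq: "graph_components (spanning_subgraph G F) = component F ` V"
  by (simp add: graph_components_def component_def conn_def)

lemma cut_set_iff: "e \<in> cut_set G F \<longleftrightarrow> e \<in> E \<and> \<not> conn F (tail e) (head e)"
proof (cases "e \<in> E")
  case True
  note ends = ends_tail_head[OF True] and verts = tail_in_verts[OF True] head_in_verts[OF True]
  have "(\<exists>x\<in>V. \<exists>y\<in>V. component F x \<noteq> component F y \<and>
      (\<exists>a\<in>component F x. \<exists>b\<in>component F y. ends G e = {a, b})) \<longleftrightarrow> \<not> conn F (tail e) (head e)"
    (is "?L \<longleftrightarrow> _")
  proof
    assume ?L
    then obtain x y a b where xy: "x \<in> V" "y \<in> V" "component F x \<noteq> component F y"
      and ab: "a \<in> component F x" "b \<in> component F y" "ends G e = {a, b}"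
      by blast
    then have "\<not> conn F x y" "conn F x a" "conn F y b"
      by (simp_all add: component_eq_iff) (simp_all add: component_def)
    then have "\<not> conn F a b" "\<not> conn F b a"
      by (meson conn_sym conn_trans)+
    then show "\<not> conn F (tail e) (head e)"
      using ab(3) ends by (auto simp: doubleton_eq_iff)
  next
    assume "\<not> conn F (tail e) (head e)"
    moreover have "tail e \<in> component F (tail e)" "head e \<in> component F (head e)"
      using verts by (simp_all add: component_def)
    ultimately show ?L
      using verts ends component_eq_iff by blast
  qed
  then show ?thesis
    using True by (simp add: cut_set_def graph_components_eq)
qed (simp add: cut_set_def)

section \<open>Forests\<close>

definition forest :: "'e set \<Rightarrow> bool" where
  "forest F \<longleftrightarrow> F \<subseteq> E \<and> acyclic_graph (spanning_subgraph G F)"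

definition is_path :: "'e set \<Rightarrow> 'v list \<Rightarrow> 'e list \<Rightarrow> bool" where
  "is_path F vs es \<longleftrightarrow> length vs = Suc (length es) \<and> distinct vs \<and> set vs \<subseteq> V \<and> set es \<subseteq> F \<and>
    (\<forall>i<length es. ends G (es ! i) = {vs ! i, vs ! Suc i})"

lemma is_path_take:
  assumes "is_path F vs es" "j \<le> length es"
  shows "is_path F (take (Suc j) vs) (take j es)"
  using assms by (auto simp: is_path_def dest: in_set_takeD)

lemma is_path_snoc:
  assumes "is_path F vs es" "e \<in> F" "ends G e = {vs ! length es, z}" "z \<in> V" "z \<notin> set vs"
  shows "is_path F (vs @ [z]) (es @ [e])"
  using assms by (auto simp: is_path_def nth_append less_Suc_eq)

lemma is_path_distinct_edges:
  assumes "is_path F vs es"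
  shows "distinct es"
  unfolding distinct_conv_nth
proof (intro allI impI notI)
  fix i j
  assume ij: "i < length es" "j < length es" "i \<noteq> j" and "es ! i = es ! j"
  then have "{vs ! i, vs ! Suc i} = {vs ! j, vs ! Suc j}"
    using assms by (metis is_path_def)
  then have "vs ! i = vs ! j \<or> vs ! i = vs ! Suc j \<and> vs ! Suc i = vs ! j"
    by (auto simp: doubleton_eq_iff)
  then show False
    using assms ij by (auto simp: is_path_def nth_eq_iff_index_eq)
qed

lemma conn_imp_path:
  assumes "conn F x y" "F \<subseteq> E" "x \<in> V"
  obtains vs es where "is_path F vs es" "vs ! 0 = x" "vs ! length es = y"
proof -
  have "\<exists>vs es. is_path F vs es \<and> vs ! 0 = x \<and> vs ! length es = y"
    using assms(1)
  proof (induction rule: conn_induct)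
    case refl
    have "is_path F [x] []"
      using assms(3) by (simp add: is_path_def)
    then show ?case
      by (intro exI[of _ "[x]"] exI[of _ "[]"]) simp
  next
    case (step y z e)
    then obtain vs es where path: "is_path F vs es" "vs ! 0 = x" "vs ! length es = y"
      by blast
    then have length: "length vs = Suc (length es)"
      by (simp add: is_path_def)
    have "z \<in> V"
      using step.hyps assms(2) ends_subset_verts[of e] by auto
    show ?case
    proof (cases "z \<in> set vs")
      case True
      then obtain j where j: "j \<le> length es" "vs ! j = z"
        using length by (auto simp: in_set_conv_nth less_Suc_eq_le)
      then show ?thesis
        using is_path_take[OF path(1) j(1)] path(2)
        by (intro exI[of _ "take (Suc j) vs"] exI[of _ "take j es"]) simp
    next
      case False
      then have "is_path F (vs @ [z]) (es @ [e])"
        using is_path_snoc[OF path(1)] step.hyps path(3) \<open>z \<in> V\<close> by simp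
      then show ?thesis
        using path(2) length
        by (intro exI[of _ "vs @ [z]"] exI[of _ "es @ [e]"]) (simp add: nth_append)
    qed
  qed
  then show thesis
    using that by blast
qed

lemma is_cycle_closed_path:
  assumes path: "is_path (F - {e}) vs es" and e: "e \<in> F" "ends G e = {vs ! length es, vs ! 0}"
  shows "is_cycle (spanning_subgraph G F) vs (es @ [e])"
  unfolding is_cycle_def
proof (intro conjI allI impI)
  fix i assume "i < length (es @ [e])"
  then consider "i < length es" | "i = length es"
    by fastforce
  then show "ends (spanning_subgraph G F) ((es @ [e]) ! i) =
      {vs ! i, vs ! (Suc i mod length (es @ [e]))}"
    by cases (use path e in \<open>auto simp: is_path_def nth_append\<close>)
qed (use path e is_path_distinct_edges[OF path] in \<open>auto simp: is_path_def\<close>)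

lemma cycle_edge_not_bridge:
  assumes "is_cycle (spanning_subgraph G F) vs es"
  obtains e x y where "e \<in> F" "ends G e = {x, y}" "conn (F - {e}) x y"
proof -
  obtain k where k: "length es = Suc k"
    using assms by (cases es) (auto simp: is_cycle_def)
  have edge: "es ! i \<in> F" "ends G (es ! i) = {vs ! i, vs ! (Suc i mod Suc k)}" if "i \<le> k" for i
    using assms that k by (auto simp: is_cycle_def subset_iff)
  have "conn (F - {es ! k}) (vs ! 0) (vs ! i)" if "i \<le> k" for i
    using that
  proof (induction i)
    case (Suc i)
    then have "es ! i \<noteq> es ! k"
      using assms k by (simp add: is_cycle_def nth_eq_iff_index_eq)
    then have "conn (F - {es ! k}) (vs ! i) (vs ! Suc i)"
      using edge[of i] Suc.prems by (intro conn_edge) auto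
    then show ?case
      using Suc conn_trans by (meson Suc_leD)
  qed simp
  then have "conn (F - {es ! k}) (vs ! k) (vs ! 0)"
    by (blast intro: conn_sym)
  with edge[of k] show thesis
    by (intro that[of "es ! k"]) auto
qed

lemma forest_subset_edges: "forest F \<Longrightarrow> F \<subseteq> E"
  by (simp add: forest_def)

lemma finite_forest: "forest F \<Longrightarrow> finite F"
  using finite_edges finite_subset forest_subset_edges by blast

lemma finite_forests: "finite {F. forest F}"
  by (rule finite_subset[of _ "Pow E"]) (auto simp: finite_edges dest: forest_subset_edges)

lemma forest_bridge:
  assumes "forest F" "e \<in> F" "ends G e = {x, y}"
  shows "\<not> conn (F - {e}) x y"
proof
  assume "conn (F - {e}) x y"
  moreover have "e \<in> E"
    using assms(1,2) forest_subset_edges by blast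
  then have "x \<in> V"
    using ends_subset_verts assms(3) by blast
  ultimately obtain vs es where "is_path (F - {e}) vs es" "vs ! 0 = x" "vs ! length es = y"
    using conn_imp_path[of "F - {e}" x y] forest_subset_edges[OF assms(1)] by blast
  then have "is_cycle (spanning_subgraph G F) vs (es @ [e])"
    using assms(2,3) by (intro is_cycle_closed_path) (auto simp: insert_commute)
  then show False
    using assms(1) by (auto simp: forest_def acyclic_graph_def)
qed

lemma forest_iff_bridges:
  "forest F \<longleftrightarrow> F \<subseteq> E \<and> (\<forall>e\<in>F. \<not> conn (F - {e}) (tail e) (head e))"
proof
  assume "forest F"
  then show "F \<subseteq> E \<and> (\<forall>e\<in>F. \<not> conn (F - {e}) (tail e) (head e))"
    using forest_bridge ends_tail_head forest_subset_edges by blast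
next
  assume F: "F \<subseteq> E \<and> (\<forall>e\<in>F. \<not> conn (F - {e}) (tail e) (head e))"
  have "\<not> is_cycle (spanning_subgraph G F) vs es" for vs es
  proof
    assume "is_cycle (spanning_subgraph G F) vs es"
    then obtain e x y where e: "e \<in> F" "ends G e = {x, y}" "conn (F - {e}) x y"
      by (rule cycle_edge_not_bridge)
    then have "{tail e, head e} = {x, y}"
      using F ends_tail_head by auto
    then have "conn (F - {e}) (tail e) (head e)"
      using e(3) by (auto simp: doubleton_eq_iff conn_commute)
    then show False
      using F e(1) by blast
  qed
  then show "forest F"
    using F by (simp add: forest_def acyclic_graph_def)
qed

lemma forest_subset: "forest F \<Longrightarrow> F' \<subseteq> F \<Longrightarrow> forest F'"
  unfolding forest_iff_bridges by (meson Diff_mono conn_mono order_refl subset_iff)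

lemma forest_insert:
  assumes F: "forest F" and e: "e \<in> E" and disconnected: "\<not> conn F (tail e) (head e)"
  shows "forest (insert e F)"
  unfolding forest_iff_bridges
proof (intro conjI ballI)
  show "insert e F \<subseteq> E"
    using F e forest_subset_edges by auto
next
  fix f assume f: "f \<in> insert e F"
  have "e \<notin> F"
    using e disconnected conn_tail_head by blast
  show "\<not> conn (insert e F - {f}) (tail f) (head f)"
  proof (cases "f = e")
    case True
    then show ?thesis
      using \<open>e \<notin> F\<close> disconnected by simp
  next
    case False
    then have f: "f \<in> F" "insert e F - {f} = insert e (F - {f})"
      using f by auto
    then have "conn F (tail f) (head f)" "\<not> conn (F - {f}) (tail f) (head f)"
      using F forest_subset_edges[OF F] conn_tail_head by (auto simp: forest_iff_bridges)
    moreover have "conn F u v" if "conn (F - {f}) u v" for u v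
      using that by (rule conn_mono) auto
    ultimately show ?thesis
      unfolding f(2) conn_insert[OF ends_tail_head[OF e]]
      using disconnected by (meson conn_sym conn_trans)
  qed
qed

lemma forest_conn_delete_iff:
  assumes "forest F" "e \<in> F" "ends G e = {x, y}" "conn F x v"
  shows "conn (F - {e}) y v \<longleftrightarrow> \<not> conn (F - {e}) x v"
proof -
  have "conn (insert e (F - {e})) x v"
    using assms(2,4) by (simp add: insert_absorb)
  then have "conn (F - {e}) x v \<or> conn (F - {e}) y v"
    unfolding conn_insert[OF assms(3)] by blast
  moreover have "\<not> conn (F - {e}) x y"
    using assms(1-3) by (rule forest_bridge)
  ultimately show ?thesis
    by (meson conn_sym conn_trans)
qed

lemma conn_imp_first_edge:
  assumes "conn F x v" "x \<noteq> v"
  obtains e y where "e \<in> F" "ends G e = {x, y}" "conn {f \<in> F. x \<notin> ends G f} y v"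
proof -
  let ?F = "{f \<in> F. x \<notin> ends G f}"
  have "v = x \<or> (\<exists>e\<in>F. \<exists>y. ends G e = {x, y} \<and> conn ?F y v)"
    using assms(1)
  proof (induction rule: conn_induct)
    case (step c d f)
    show ?case
    proof (cases "c = x \<or> d = x")
      case True
      then show ?thesis
        using step.hyps by (auto intro: conn_refl)
    next
      case False
      then have "conn ?F c d"
        using step.hyps by (intro conn_edge[of f]) auto
      then show ?thesis
        using step.IH False by (blast intro: conn_trans)
    qed
  qed simp
  then show thesis
    using that assms(2) by blast
qed

lemma card_separating_edges_at:
  assumes "forest F" "conn F x v"
  shows "card {e \<in> F. x \<in> ends G e \<and> \<not> conn (F - {e}) x v} = of_bool (x \<noteq> v)"
proof (cases "x = v")
  case False
  then obtain e y where e: "e \<in> F" "ends G e = {x, y}"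
    and rest: "conn {f \<in> F. x \<notin> ends G f} y v"
    using conn_imp_first_edge[OF assms(2)] by metis
  have y_v: "conn (F - {f}) y v" if "x \<in> ends G f" for f
    using rest by (rule conn_mono) (use that in auto)
  have "\<not> conn (F - {f}) x v \<longleftrightarrow> f = e" if f: "f \<in> F" "x \<in> ends G f" for f
  proof
    assume disconnected: "\<not> conn (F - {f}) x v"
    show "f = e"
    proof (rule ccontr)
      assume "f \<noteq> e"
      then have "conn (F - {f}) x y"
        using e by (intro conn_edge) auto
      then show False
        using disconnected y_v[OF f(2)] conn_trans by blast
    qed
  next
    assume "f = e"
    then show "\<not> conn (F - {f}) x v"
      using forest_bridge[OF assms(1) e] y_v[OF f(2)] by (blast intro: conn_sym conn_trans)
  qed
  then have "{f \<in> F. x \<in> ends G f \<and> \<not> conn (F - {f}) x v} = {e}"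
    using e by auto
  then show ?thesis
    using False by simp
qed simp

lemma card_separated_ends:
  assumes F: "forest F" and e: "e \<in> F" and x: "x \<in> ends G e" "conn F x a"
  shows "card {v \<in> ends G e. \<not> conn (F - {e}) v a} = 1"
proof -
  have "e \<in> E"
    using forest_subset_edges[OF F] e by blast
  then have ends: "ends G e = {x, other e x}"
    using x(1) by (rule ends_other)
  then have "conn (F - {e}) (other e x) a \<longleftrightarrow> \<not> conn (F - {e}) x a"
    by (rule forest_conn_delete_iff[OF F e _ x(2)])
  then have "{v \<in> {x, other e x}. \<not> conn (F - {e}) v a} =
      {if conn (F - {e}) x a then other e x else x}"
    by auto
  then show ?thesis
    by (simp add: ends)
qed

text \<open>Count the pairs of a vertex \<open>v\<close> of the component and an edge at \<open>v\<close> separating \<open>v\<close> from \<open>a\<close>: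
  every \<open>v \<noteq> a\<close> has exactly one such edge, and every edge has exactly one such end.\<close>

lemma card_component_forest:
  assumes F: "forest F" and a: "a \<in> V"
  shows "card (component F a) = Suc (card {e \<in> F. ends G e \<subseteq> component F a})"
proof -
  let ?C = "component F a" and ?D = "{e \<in> F. ends G e \<subseteq> component F a}"
  have finite: "finite ?C" "finite ?D" and "a \<in> ?C"
    using a finite_verts finite_forest[OF F] by (auto simp: component_def)
  have conn_a: "conn F v a" if "v \<in> ?C" for v
    using that by (auto simp: component_def intro: conn_sym)
  have "(\<Sum>v\<in>?C. card {e \<in> ?D. v \<in> ends G e \<and> \<not> conn (F - {e}) v a}) = 1 * card ?D"
  proof (rule sum_multicount[OF finite], intro ballI)
    fix e assume e: "e \<in> ?D"
    then have "tail e \<in> ends G e"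
      using ends_tail_head forest_subset_edges[OF F] by blast
    then have "card {v \<in> ends G e. \<not> conn (F - {e}) v a} = 1"
      using e conn_a card_separated_ends[OF F] by blast
    moreover have "{v \<in> ?C. v \<in> ends G e \<and> \<not> conn (F - {e}) v a} =
        {v \<in> ends G e. \<not> conn (F - {e}) v a}"
      using e by auto
    ultimately show "card {v \<in> ?C. v \<in> ends G e \<and> \<not> conn (F - {e}) v a} = 1"
      by simp
  qed
  moreover have "card {e \<in> ?D. v \<in> ends G e \<and> \<not> conn (F - {e}) v a} = of_bool (v \<noteq> a)"
    if v: "v \<in> ?C" for v
  proof -
    have "{e \<in> ?D. v \<in> ends G e \<and> \<not> conn (F - {e}) v a} =
        {e \<in> F. v \<in> ends G e \<and> \<not> conn (F - {e}) v a}"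
      using ends_subset_component[OF forest_subset_edges[OF F]] v by blast
    then show ?thesis
      using card_separating_edges_at[OF F conn_a[OF v]] by simp
  qed
  ultimately have "card ?D = (\<Sum>v\<in>?C. of_bool (v \<noteq> a))"
    by simp
  also have "\<dots> = card (?C - {a})"
    using finite by (simp add: Int_def set_diff_eq)
  finally show ?thesis
    using \<open>a \<in> ?C\<close> finite card_Suc_Diff1 by metis
qed

section \<open>Rooted forests\<close>

definition rooted_forests :: "'v set \<Rightarrow> 'e set set" where
  "rooted_forests Q = {F. forest F \<and> (\<forall>v\<in>V. \<exists>r\<in>Q. conn F v r) \<and>
     (\<forall>r\<in>Q. \<forall>r'\<in>Q. conn F r r' \<longrightarrow> r = r')}"

definition spanning_trees :: "'e set set" where
  "spanning_trees = {T. forest T \<and> (\<forall>x\<in>V. \<forall>y\<in>V. conn T x y)}"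

lemma rooted_forests_forest: "F \<in> rooted_forests Q \<Longrightarrow> forest F"
  by (simp add: rooted_forests_def)

lemma rooted_forests_root:
  assumes "F \<in> rooted_forests Q" "v \<in> V"
  obtains r where "r \<in> Q" "conn F v r"
  using assms by (auto simp: rooted_forests_def)

lemma rooted_forests_root_unique:
  assumes "F \<in> rooted_forests Q" "r \<in> Q" "r' \<in> Q" "conn F r r'"
  shows "r = r'"
  using assms by (simp add: rooted_forests_def)

lemma finite_rooted_forests: "finite (rooted_forests Q)"
  using finite_forests by (rule rev_finite_subset) (auto simp: rooted_forests_def)

lemma finite_spanning_trees: "finite spanning_trees"
  using finite_forests by (rule rev_finite_subset) (auto simp: spanning_trees_def)

lemma finite_two_forests: "finite (two_forests G)"
  using finite_forests by (rule rev_finite_subset) (auto simp: two_forests_def forest_def)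

lemma two_forests_iff:
  "F \<in> two_forests G \<longleftrightarrow> forest F \<and>
    (\<exists>a\<in>V. \<exists>b\<in>V. \<not> conn F a b \<and> (\<forall>v\<in>V. conn F v a \<or> conn F v b))"
  by (auto simp: two_forests_def forest_def graph_components_eq card_image_eq_2_iff component_eq_iff)

lemma two_forests_conn_iff:
  assumes "F \<in> two_forests G" "a \<in> V" "b \<in> V" "\<not> conn F a b" "v \<in> V"
  shows "conn F v a \<longleftrightarrow> \<not> conn F v b"
proof -
  obtain c d where "\<And>u. u \<in> V \<Longrightarrow> conn F u c \<or> conn F u d"
    using assms(1) unfolding two_forests_iff by blast
  then show ?thesis
    using assms(2-5) by (meson conn_sym conn_trans)
qed

lemma rooted_forests_singleton: "q \<in> V \<Longrightarrow> rooted_forests {q} = spanning_trees"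
  unfolding rooted_forests_def spanning_trees_def by (auto intro: conn_sym conn_trans)

lemma rooted_forests_doubleton:
  assumes "p \<in> V" "q \<in> V" "p \<noteq> q"
  shows "rooted_forests {p, q} = {F \<in> two_forests G. \<not> conn F p q}"
proof safe
  fix F assume F: "F \<in> rooted_forests {p, q}"
  then show "conn F p q \<Longrightarrow> False"
    using rooted_forests_root_unique[OF F] assms(3) by blast
  then show "F \<in> two_forests G"
    using F assms(1,2) unfolding rooted_forests_def two_forests_iff by blast
next
  fix F assume F: "F \<in> two_forests G" "\<not> conn F p q"
  then show "F \<in> rooted_forests {p, q}"
    using two_forests_conn_iff[OF F(1) assms(1,2) F(2)]
    by (auto simp: rooted_forests_def two_forests_iff conn_commute)
qed

lemma rooted_forests_insert_edge:
  assumes F: "F \<in> rooted_forests (insert w Q)" and w: "\<forall>r\<in>Q. \<not> conn F w r"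
    and e: "e \<in> E" "ends G e = {x, y}" and w_x: "conn F w x" and w_y: "\<not> conn F w y"
  shows "insert e F \<in> rooted_forests Q"
proof -
  note conn_insert_e = conn_insert[OF e(2), of F]
  have "\<not> conn F x y"
    using w_x w_y conn_trans by blast
  then have "\<not> conn F (tail e) (head e)"
    using e ends_tail_head[OF e(1)] conn_commute by (auto simp: doubleton_eq_iff)
  then have forest: "forest (insert e F)"
    using F e(1) by (intro forest_insert rooted_forests_forest)
  have "y \<in> V"
    using e ends_subset_verts by blast
  then obtain r where r: "r \<in> Q" "conn F y r"
    using rooted_forests_root[OF F] w_y conn_sym by (metis insertE)
  have "\<exists>r\<in>Q. conn (insert e F) v r" if "v \<in> V" for v
  proof -
    obtain r' where "r' = w \<or> r' \<in> Q" "conn F v r'"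
      using rooted_forests_root[OF F \<open>v \<in> V\<close>] by blast
    then consider "conn F v x" | "r' \<in> Q" "conn F v r'"
      using w_x conn_trans by blast
    then show ?thesis
      using r by cases (auto simp: conn_insert_e)
  qed
  moreover have "r = r'" if "r \<in> Q" "r' \<in> Q" "conn (insert e F) r r'" for r r'
  proof -
    have "\<not> conn F r x" "\<not> conn F x r'"
      using that(1,2) w w_x by (meson conn_sym conn_trans)+
    then have "conn F r r'"
      using that(3) by (simp add: conn_insert_e)
    then show ?thesis
      using rooted_forests_root_unique[OF F] that(1,2) by blast
  qed
  ultimately show ?thesis
    using forest by (simp add: rooted_forests_def)
qed

lemma rooted_forests_delete_edge:
  assumes T: "T \<in> rooted_forests Q" and e: "e \<in> T" and w: "w \<in> V"
    and separated: "\<forall>r\<in>Q. \<not> conn (T - {e}) w r"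
  shows "T - {e} \<in> rooted_forests (insert w Q)"
proof -
  let ?F = "T - {e}"
  have forest: "forest T"
    using T by (rule rooted_forests_forest)
  have conn_T: "conn T a b" if "conn ?F a b" for a b
    using that by (rule conn_mono) auto
  have "\<exists>r\<in>insert w Q. conn ?F v r" if "v \<in> V" for v
  proof (cases "\<exists>r\<in>Q. conn ?F v r")
    case False
    obtain r where r: "r \<in> Q" "conn T w r"
      using rooted_forests_root[OF T w] .
    obtain r' where r': "r' \<in> Q" "conn T v r'"
      using rooted_forests_root[OF T \<open>v \<in> V\<close>] .
    have "ends G e = {tail e, head e}"
      using e forest forest_subset_edges ends_tail_head by blast
    then have conn_T_iff: "conn T a b \<longleftrightarrow> conn ?F a b \<or>
        conn ?F a (tail e) \<and> conn ?F (head e) b \<or> conn ?F a (head e) \<and> conn ?F (tail e) b" for a b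
      using conn_insert[of e "tail e" "head e" ?F] e by (simp add: insert_absorb)
    have "conn ?F v w"
      using r r' False separated unfolding conn_T_iff by (meson conn_sym conn_trans)
    then show ?thesis
      by blast
  qed blast
  moreover have "r = r'" if "r \<in> insert w Q" "r' \<in> insert w Q" "conn ?F r r'" for r r'
    using that separated rooted_forests_root_unique[OF T] conn_T by (auto dest: conn_sym)
  ultimately show ?thesis
    using forest forest_subset by (auto simp: rooted_forests_def)
qed

text \<open>For a forest \<open>T\<close> rooted at \<open>Q\<close>: the path in \<open>T\<close> from \<open>w\<close> to its root leaves \<open>x\<close> along \<open>e\<close>.\<close>

definition departs :: "'v set \<Rightarrow> 'v \<Rightarrow> 'v \<Rightarrow> 'e \<Rightarrow> 'e set \<Rightarrow> bool" where
  "departs Q w x e T \<longleftrightarrow> e \<in> T \<and> conn (T - {e}) w x \<and> (\<forall>r\<in>Q. \<not> conn (T - {e}) w r)"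

lemma card_departs_eq:
  assumes w: "w \<in> V" and e: "e \<in> E" "ends G e = {x, y}"
  shows "card {T \<in> rooted_forests Q. departs Q w x e T} =
    card {F \<in> rooted_forests (insert w Q). (conn F w x \<and> (\<forall>r\<in>Q. \<not> conn F w r)) \<and> \<not> conn F w y}"
    (is "card ?A = card ?B")
proof (rule bij_betw_same_card[of "\<lambda>T. T - {e}"], rule bij_betw_byWitness[where f' = "insert e"])
  have e_notin: "e \<notin> F" if "F \<in> ?B" for F
    using that conn_edge[OF _ e(2)] conn_trans by blast
  then show "\<forall>F\<in>?B. insert e F - {e} = F"
    by simp
  show "\<forall>T\<in>?A. insert e (T - {e}) = T"
    by (auto simp: departs_def)
  show "insert e ` ?B \<subseteq> ?A"
    using rooted_forests_insert_edge[OF _ _ e] e_notin by (auto simp: departs_def)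
  show "(\<lambda>T. T - {e}) ` ?A \<subseteq> ?B"
  proof (intro image_subsetI)
    fix T assume "T \<in> ?A"
    then have T: "T \<in> rooted_forests Q" "e \<in> T"
      and w_x: "conn (T - {e}) w x" and separated: "\<forall>r\<in>Q. \<not> conn (T - {e}) w r"
      by (auto simp: departs_def)
    have "\<not> conn (T - {e}) x y"
      using forest_bridge[OF rooted_forests_forest[OF T(1)] T(2) e(2)] .
    then have "\<not> conn (T - {e}) w y"
      using w_x conn_cong by blast
    then show "T - {e} \<in> ?B"
      using rooted_forests_delete_edge[OF T w separated] w_x separated by blast
  qed
qed

lemma departs_diff:
  assumes T: "T \<in> rooted_forests Q" and e: "e \<in> T" "ends G e = {x, y}"
    and r: "r \<in> Q" "conn T w r" and x_w: "conn T x w"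
  shows "of_bool (departs Q w x e T) - of_bool (departs Q w y e T) =
    (of_bool (\<not> conn (T - {e}) x r) - of_bool (\<not> conn (T - {e}) x w) :: int)"
proof -
  let ?F = "T - {e}"
  have "conn T w r'" if "conn ?F w r'" for r'
    using that by (rule conn_mono) auto
  then have "(\<forall>r'\<in>Q. \<not> conn ?F w r') \<longleftrightarrow> \<not> conn ?F w r"
    using r rooted_forests_root_unique[OF T] by (metis conn_cong)
  then have departs: "departs Q w z e T \<longleftrightarrow> conn ?F z w \<and> \<not> conn ?F z r" for z
    using e(1) by (auto simp: departs_def intro: conn_sym conn_trans)
  have "conn T x r"
    using x_w r(2) by (rule conn_trans)
  then have "conn ?F y w \<longleftrightarrow> \<not> conn ?F x w" "conn ?F y r \<longleftrightarrow> \<not> conn ?F x r"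
    using forest_conn_delete_iff[OF rooted_forests_forest[OF T] e] x_w by blast+
  then show ?thesis
    unfolding departs by auto
qed

lemma departs_imp_conn: "departs Q w x e T \<Longrightarrow> conn T w x"
  unfolding departs_def by (blast intro: conn_mono)

lemma sum_departs_diff_component:
  assumes T: "T \<in> rooted_forests Q" and r: "r \<in> Q" "conn T w r"
    and x: "x \<notin> Q" and x_w: "conn T x w"
  shows "(\<Sum>e\<in>{e \<in> T. x \<in> ends G e}.
    of_bool (departs Q w x e T) - of_bool (departs Q w (other e x) e T) :: int) = of_bool (x = w)"
    (is "sum ?d ?I = _")
proof -
  have forest: "forest T"
    using T by (rule rooted_forests_forest)
  let ?separates = "\<lambda>e v. of_bool (\<not> conn (T - {e}) x v) :: int"
  have count: "(\<Sum>e\<in>?I. ?separates e v) = of_bool (x \<noteq> v)" if "conn T x v" for v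
    using card_separating_edges_at[OF forest that] finite_forest[OF forest]
    by (simp add: Int_def conj_assoc)
  have "sum ?d ?I = (\<Sum>e\<in>?I. ?separates e r - ?separates e w)"
  proof (rule sum.cong[OF refl])
    fix e assume "e \<in> ?I"
    then have e: "e \<in> T" "ends G e = {x, other e x}"
      using forest_subset_edges[OF forest] ends_other by auto
    show "?d e = ?separates e r - ?separates e w"
      using departs_diff[OF T e r x_w] .
  qed
  also have "\<dots> = of_bool (x \<noteq> r) - of_bool (x \<noteq> w)"
    using count[OF x_w] count[OF conn_trans[OF x_w r(2)]] by (simp only: sum_subtractf)
  also have "\<dots> = of_bool (x = w)"
    using r(1) x by auto
  finally show ?thesis .
qed

text \<open>Kirchhoff's node law for the unit flow along the path from \<open>w\<close> to its root.\<close>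

lemma sum_departs_diff:
  assumes T: "T \<in> rooted_forests Q" and w: "w \<in> V" and x: "x \<notin> Q"
  shows "(\<Sum>e\<in>incident x. of_bool (departs Q w x e T) - of_bool (departs Q w (other e x) e T) :: int)
    = of_bool (x = w)" (is "sum ?d _ = _")
proof -
  have T_edges: "T \<subseteq> E"
    using T by (intro forest_subset_edges rooted_forests_forest)
  let ?I = "{e \<in> T. x \<in> ends G e}"
  have "sum ?d (incident x) = sum ?d ?I"
    using T_edges
    by (intro sum.mono_neutral_right finite_incident) (auto simp: incident_def departs_def)
  also have "\<dots> = of_bool (x = w)"
  proof (cases "conn T x w")
    case True
    obtain r where "r \<in> Q" "conn T w r"
      using rooted_forests_root[OF T w] .
    then show ?thesis
      using sum_departs_diff_component[OF T _ _ x True] by blast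
  next
    case False
    have "?d e = 0" if e: "e \<in> ?I" for e
    proof -
      have "ends G e = {x, other e x}"
        using e T_edges ends_other by blast
      then have "conn T x (other e x)"
        using e conn_edge by blast
      then have "\<not> conn T w x" "\<not> conn T w (other e x)"
        using False by (meson conn_sym conn_trans)+
      then show ?thesis
        using departs_imp_conn by auto
    qed
    then show ?thesis
      using False by auto
  qed
  finally show ?thesis .
qed

section \<open>The Laplacian and its Green functions\<close>

definition laplacian :: "('v \<Rightarrow> real) \<Rightarrow> 'v \<Rightarrow> real" where
  "laplacian f x = (\<Sum>e\<in>incident x. f x - f (other e x))"

lemma laplacian_diff: "laplacian (\<lambda>x. f x - g x) x = laplacian f x - laplacian g x"
  by (simp add: laplacian_def algebra_simps flip: sum_subtractf)

lemma laplacian_scale: "laplacian (\<lambda>x. c * f x) x = c * laplacian f x"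
  by (simp add: laplacian_def sum_distrib_left right_diff_distrib)

lemma dirichlet_energy:
  "(\<Sum>x\<in>V. f x * laplacian f x) = (\<Sum>e\<in>E. (f (tail e) - f (head e))\<^sup>2)"
  unfolding laplacian_def sum_distrib_left sum_incident
  by (intro sum.cong) (auto simp: power2_eq_square algebra_simps)

text \<open>Divided by the number of forests rooted at \<open>Q\<close>, this is the Green function of the Laplacian
  grounded at \<open>Q\<close>. The condition on \<open>Q\<close> is automatic unless \<open>w \<in> Q\<close>, where it makes the value \<open>0\<close>.\<close>

definition green :: "'v set \<Rightarrow> 'v \<Rightarrow> 'v \<Rightarrow> nat" where
  "green Q w x = card {F \<in> rooted_forests (insert w Q). conn F w x \<and> (\<forall>r\<in>Q. \<not> conn F w r)}"

lemma green_root_left: "w \<in> Q \<Longrightarrow> green Q w x = 0"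
proof -
  assume "w \<in> Q"
  then have "{F \<in> rooted_forests (insert w Q). conn F w x \<and> (\<forall>r\<in>Q. \<not> conn F w r)} = {}"
    using conn_refl by blast
  then show ?thesis
    unfolding green_def by (simp only: card.empty)
qed

lemma green_root_right: "x \<in> Q \<Longrightarrow> green Q w x = 0"
  unfolding green_def by (auto simp: card_eq_0_iff)

lemma green_diag: "w \<notin> Q \<Longrightarrow> green Q w w = card (rooted_forests (insert w Q))"
proof -
  assume w: "w \<notin> Q"
  have "\<not> conn F w r" if "F \<in> rooted_forests (insert w Q)" "r \<in> Q" for F r
    using rooted_forests_root_unique[OF that(1), of w r] that(2) w by auto
  then show ?thesis
    unfolding green_def by (intro arg_cong[where f = card]) auto
qed

lemma green_singleton:
  assumes "w \<in> V" "q \<in> V"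
  shows "green {q} w x = card {F \<in> two_forests G. \<not> conn F w q \<and> conn F w x}"
proof (cases "w = q")
  case False
  then show ?thesis
    unfolding green_def rooted_forests_doubleton[OF assms False]
    by (intro arg_cong[where f = card]) auto
qed (simp add: green_root_left)

lemma green_commute:
  assumes "q \<in> V" "x \<in> V" "y \<in> V"
  shows "green {q} x y = green {q} y x"
  unfolding green_singleton[OF assms(2,1)] green_singleton[OF assms(3,1)]
  by (intro arg_cong[where f = card]) (auto intro: conn_sym conn_trans)

lemma green_diff:
  assumes w: "w \<in> V" and e: "e \<in> E" "ends G e = {x, y}"
  shows "int (green Q w x) - int (green Q w y) =
    int (card {T \<in> rooted_forests Q. departs Q w x e T}) -
    int (card {T \<in> rooted_forests Q. departs Q w y e T})"
proof -
  let ?P = "\<lambda>z F. conn F w z \<and> (\<forall>r\<in>Q. \<not> conn F w r)"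
  have "ends G e = {y, x}"
    using e(2) by (simp add: insert_commute)
  note departs = card_departs_eq[OF w e] card_departs_eq[OF w e(1) this]
  have "{F \<in> rooted_forests (insert w Q). ?P x F \<and> conn F w y} =
      {F \<in> rooted_forests (insert w Q). ?P y F \<and> conn F w x}"
    by blast
  then show ?thesis
    unfolding green_def departs
    using card_Collect_split[OF finite_rooted_forests, of "insert w Q" "?P x" "\<lambda>F. conn F w y"]
      card_Collect_split[OF finite_rooted_forests, of "insert w Q" "?P y" "\<lambda>F. conn F w x"]
    by simp
qed

lemma card_departs_to_root:
  assumes "w \<in> V" "e \<in> E" "ends G e = {w, r}" "r \<in> Q"
  shows "card {T \<in> rooted_forests Q. departs Q w w e T} = green Q w w"
  unfolding card_departs_eq[OF assms(1-3)] green_def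
  using assms(4) by (intro arg_cong[where f = card]) auto

lemma laplacian_green:
  assumes w: "w \<in> V" and x: "x \<notin> Q"
  shows "laplacian (\<lambda>x. real (green Q w x)) x = of_bool (x = w) * real (card (rooted_forests Q))"
proof -
  let ?d = "\<lambda>z e T. of_bool (departs Q w z e T) :: int"
  have count: "int (card {T \<in> rooted_forests Q. departs Q w z e T}) = (\<Sum>T\<in>rooted_forests Q. ?d z e T)"
    for z e
    by (simp add: finite_rooted_forests Int_def)
  have "(\<Sum>e\<in>incident x. int (green Q w x) - int (green Q w (other e x))) =
      (\<Sum>e\<in>incident x. \<Sum>T\<in>rooted_forests Q. ?d x e T - ?d (other e x) e T)"
    using green_diff[OF w _ ends_incident]
    by (intro sum.cong refl) (simp add: incident_def count sum_subtractf del: sum_of_bool_eq)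
  also have "\<dots> = (\<Sum>T\<in>rooted_forests Q. \<Sum>e\<in>incident x. ?d x e T - ?d (other e x) e T)"
    by (rule sum.swap)
  also have "\<dots> = (\<Sum>T\<in>rooted_forests Q. of_bool (x = w))"
    by (intro sum.cong refl sum_departs_diff w x)
  also have "\<dots> = of_bool (x = w) * int (card (rooted_forests Q))"
    by simp
  finally have "real_of_int (\<Sum>e\<in>incident x. int (green Q w x) - int (green Q w (other e x))) =
      real_of_int (of_bool (x = w) * int (card (rooted_forests Q)))"
    by (rule arg_cong)
  then show ?thesis
    by (simp add: laplacian_def)
qed

section \<open>Counting two-forests and spanning trees\<close>

definition cut_count :: "'e \<Rightarrow> nat" where
  "cut_count e = card {F \<in> two_forests G. e \<in> cut_set G F}"

definition away_count :: "'v \<Rightarrow> 'e \<Rightarrow> nat" where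
  "away_count q e = card {F \<in> two_forests G. e \<in> F \<and> \<not> conn F (tail e) q}"

lemma sum_card_cut_set: "(\<Sum>F\<in>two_forests G. card (cut_set G F)) = (\<Sum>e\<in>E. cut_count e)"
proof -
  have "cut_set G F = {e \<in> E. e \<in> cut_set G F}" for F
    by (auto simp: cut_set_def)
  then show ?thesis
    using sum_multicount_gen[OF finite_two_forests finite_edges, of "\<lambda>F e. e \<in> cut_set G F" cut_count]
    by (simp add: cut_count_def)
qed

lemma cut_count_eq_card_spanning_trees:
  assumes e: "e \<in> E"
  shows "cut_count e = card {T \<in> spanning_trees. e \<in> T}"
proof -
  let ?u = "tail e" and ?w = "head e"
  note verts = tail_in_verts[OF e] head_in_verts[OF e]
  have "cut_count e = green {?w} ?u ?u"
    using e verts by (simp add: cut_count_def cut_set_iff green_singleton)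
  also have "\<dots> = card {T \<in> rooted_forests {?w}. departs {?w} ?u ?u e T}"
    using card_departs_to_root[OF verts(1) e ends_tail_head[OF e]] by simp
  also have "{T \<in> rooted_forests {?w}. departs {?w} ?u ?u e T} = {T \<in> spanning_trees. e \<in> T}"
    unfolding rooted_forests_singleton[OF verts(2)]
    by (auto simp: departs_def spanning_trees_def forest_iff_bridges)
  finally show ?thesis .
qed

lemma card_spanning_tree:
  assumes T: "T \<in> spanning_trees" and "V \<noteq> {}"
  shows "card V = Suc (card T)"
proof -
  obtain a where a: "a \<in> V"
    using \<open>V \<noteq> {}\<close> by blast
  have forest: "forest T" and connected: "\<And>x y. x \<in> V \<Longrightarrow> y \<in> V \<Longrightarrow> conn T x y"
    using T by (auto simp: spanning_trees_def)
  have "component T a = V"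
    using connected a by (auto simp: component_def)
  moreover have "{e \<in> T. ends G e \<subseteq> V} = T"
    using ends_subset_verts forest_subset_edges[OF forest] by auto
  ultimately show ?thesis
    using card_component_forest[OF forest a] by simp
qed

lemma sum_cut_count:
  assumes "V \<noteq> {}"
  shows "(\<Sum>e\<in>E. real (cut_count e)) = (real (card V) - 1) * real (card spanning_trees)"
proof -
  have "(\<Sum>e\<in>E. cut_count e) = (\<Sum>e\<in>E. card {T \<in> spanning_trees. e \<in> T})"
    by (intro sum.cong refl cut_count_eq_card_spanning_trees)
  also have "\<dots> = (card V - 1) * card spanning_trees"
  proof (rule sum_multicount[OF finite_edges finite_spanning_trees], intro ballI)
    fix T assume T: "T \<in> spanning_trees"
    then have "{e \<in> E. e \<in> T} = T"
      using forest_subset_edges by (auto simp: spanning_trees_def)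
    then show "card {e \<in> E. e \<in> T} = card V - 1"
      using card_spanning_tree[OF T assms] by simp
  qed
  moreover have "card V \<ge> 1"
    using assms finite_verts by (simp add: Suc_le_eq card_gt_0_iff)
  ultimately show ?thesis
    by (simp add: of_nat_diff flip: of_nat_sum)
qed

text \<open>Divided by the number of spanning trees, this is the effective resistance between \<open>u\<close> and \<open>v\<close>.\<close>

lemma card_two_forests_separating:
  assumes verts: "u \<in> V" "v \<in> V" "q \<in> V"
  shows "card {F \<in> two_forests G. \<not> conn F u v} + 2 * green {q} u v = green {q} u u + green {q} v v"
proof -
  note split = card_Collect_split[OF finite_two_forests]
  have "{F \<in> two_forests G. \<not> conn F u v \<and> \<not> \<not> conn F u q} =
      {F \<in> two_forests G. \<not> conn F v q \<and> \<not> conn F v u}"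
    using two_forests_conn_iff[OF _ verts(1,2) _ verts(3)] by (auto intro: conn_sym conn_trans)
  moreover have "{F \<in> two_forests G. \<not> conn F u v \<and> \<not> conn F u q} =
      {F \<in> two_forests G. \<not> conn F u q \<and> \<not> conn F u v}"
    by blast
  moreover have "{F \<in> two_forests G. \<not> conn F v q \<and> conn F v u} =
      {F \<in> two_forests G. \<not> conn F u q \<and> conn F u v}"
    by (auto intro: conn_sym conn_trans)
  ultimately show ?thesis
    using split[of "\<lambda>F. \<not> conn F u v" "\<lambda>F. \<not> conn F u q"]
      split[of "\<lambda>F. \<not> conn F u q" "\<lambda>F. conn F u v"]
      split[of "\<lambda>F. \<not> conn F v q" "\<lambda>F. conn F v u"]
    by (simp add: green_singleton verts)
qed

lemma cut_count_eq_green: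
  assumes e: "e \<in> E" and q: "q \<in> V"
  shows "real (cut_count e) = real (green {q} (tail e) (tail e)) + real (green {q} (head e) (head e)) -
    2 * real (green {q} (tail e) (head e))"
proof -
  have "cut_count e = card {F \<in> two_forests G. \<not> conn F (tail e) (head e)}"
    using e by (simp add: cut_count_def cut_set_iff)
  then show ?thesis
    using card_two_forests_separating[OF tail_in_verts[OF e] head_in_verts[OF e] q] by linarith
qed

lemma card_verts_away:
  assumes F: "F \<in> two_forests G" and q: "q \<in> V"
  shows "card {v \<in> V. \<not> conn F v q} = Suc (card {e \<in> E. e \<in> F \<and> \<not> conn F (tail e) q})"
proof -
  have forest: "forest F"
    using F by (simp add: two_forests_iff)
  obtain a where a: "a \<in> V" "\<not> conn F a q"
    using F unfolding two_forests_iff by (meson conn_sym conn_trans)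
  have away: "\<not> conn F v q \<longleftrightarrow> conn F a v" if "v \<in> V" for v
    using two_forests_conn_iff[OF F a(1) q a(2) that] conn_commute by blast
  then have component: "component F a = {v \<in> V. \<not> conn F v q}"
    by (auto simp: component_def)
  have edges: "F \<subseteq> E"
    using forest by (rule forest_subset_edges)
  have "ends G e \<subseteq> component F a \<longleftrightarrow> \<not> conn F (tail e) q" if "e \<in> F" for e
  proof -
    have "tail e \<in> ends G e" "tail e \<in> V"
      using that edges ends_tail_head tail_in_verts by blast+
    then show ?thesis
      using ends_subset_component[OF edges that, of "tail e" a] component by auto
  qed
  then have "{e \<in> F. ends G e \<subseteq> component F a} = {e \<in> E. e \<in> F \<and> \<not> conn F (tail e) q}"
    using edges by blast
  with component show ?thesis
    using card_component_forest[OF forest a(1)] by simp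
qed

lemma card_two_forests_eq_sum:
  assumes q: "q \<in> V"
  shows "card (two_forests G) + (\<Sum>e\<in>E. away_count q e) = (\<Sum>v\<in>V. green {q} v v)"
proof -
  have "(\<Sum>F\<in>two_forests G. card {v \<in> V. \<not> conn F v q}) = (\<Sum>v\<in>V. green {q} v v)"
    using q by (intro sum_multicount_gen finite_two_forests finite_verts) (simp add: green_singleton)
  moreover have "(\<Sum>F\<in>two_forests G. card {e \<in> E. e \<in> F \<and> \<not> conn F (tail e) q}) =
      (\<Sum>e\<in>E. away_count q e)"
    by (intro sum_multicount_gen finite_two_forests finite_edges) (simp add: away_count_def)
  ultimately show ?thesis
    using q by (simp add: card_verts_away sum_Suc)
qed

lemma away_count_eq_green:
  assumes e: "e \<in> E" and q: "q \<in> V" "head e \<noteq> q"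
  shows "away_count q e = green {head e, q} (tail e) (tail e)"
proof -
  let ?u = "tail e" and ?w = "head e"
  note verts = tail_in_verts[OF e] head_in_verts[OF e]
  have "departs {?w, q} ?u ?u e F \<and> \<not> conn F ?w q \<longleftrightarrow> e \<in> F \<and> \<not> conn F ?u q"
    if F: "F \<in> two_forests G" for F
  proof (cases "e \<in> F")
    case True
    have "conn F ?w q \<longleftrightarrow> conn F ?u q"
      using conn_tail_head[OF True e] conn_cong by blast
    moreover have "\<not> conn (F - {e}) ?u ?w"
      using F True by (auto simp: two_forests_iff forest_iff_bridges)
    moreover have "conn F ?u q" if "conn (F - {e}) ?u q"
      using that by (rule conn_mono) auto
    ultimately show ?thesis
      using True by (auto simp: departs_def)
  qed (simp add: departs_def)
  then have "{F \<in> two_forests G. e \<in> F \<and> \<not> conn F ?u q} =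
      {T \<in> rooted_forests {?w, q}. departs {?w, q} ?u ?u e T}"
    unfolding rooted_forests_doubleton[OF verts(2) q] by blast
  also have "card \<dots> = green {?w, q} ?u ?u"
    using card_departs_to_root[OF verts(1) e ends_tail_head[OF e]] by simp
  finally show ?thesis
    by (simp add: away_count_def)
qed

end

section \<open>Connected multigraphs\<close>

locale connected_multigraph = fin_multigraph G for G :: "('v, 'e) multigraph" +
  assumes connected: "connected_graph G"
begin

lemma conn_edges: "x \<in> V \<Longrightarrow> y \<in> V \<Longrightarrow> conn E x y"
  using connected by (simp add: connected_graph_def conn_def spanning_subgraph_edges)

lemma spanning_trees_nonempty: "spanning_trees \<noteq> {}"
proof -
  have "forest {}"
    by (simp add: forest_iff_bridges)
  then obtain T where T: "forest T" and maximal: "\<And>F. forest F \<Longrightarrow> T \<subseteq> F \<Longrightarrow> T = F"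
    using finite_has_maximal[OF finite_forests] by auto
  have edge: "conn T (tail e) (head e)" if "e \<in> E" for e
  proof (rule ccontr)
    assume disconnected: "\<not> conn T (tail e) (head e)"
    then have "e \<in> T"
      using maximal[OF forest_insert[OF T that]] by blast
    then show False
      using disconnected conn_tail_head that by blast
  qed
  have "conn T x y" if "x \<in> V" "y \<in> V" for x y
    using conn_edges[OF that]
  proof (induction rule: conn_induct)
    case (step y z e)
    then have "conn T y z"
      using edge[of e] ends_tail_head[of e] by (auto simp: doubleton_eq_iff intro: conn_sym)
    then show ?case
      using step.IH conn_trans by blast
  qed simp
  then show ?thesis
    using T by (auto simp: spanning_trees_def)
qed

lemma harmonic_off_zeros_imp_zero:
  assumes harmonic: "\<And>x. x \<in> V \<Longrightarrow> f x = 0 \<or> laplacian f x = 0"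
    and b: "b \<in> V" "f b = 0" and x: "x \<in> V"
  shows "f x = 0"
proof -
  have "(\<Sum>e\<in>E. (f (tail e) - f (head e))\<^sup>2) = 0"
    unfolding dirichlet_energy[symmetric] using harmonic by (intro sum.neutral) auto
  then have edge: "f (tail e) = f (head e)" if "e \<in> E" for e
    using that finite_edges by (simp add: sum_nonneg_eq_0_iff)
  show ?thesis
    using conn_edges[OF b(1) x]
  proof (induction rule: conn_induct)
    case (step y z e)
    then show ?case
      using edge[of e] ends_tail_head[of e] by (auto simp: doubleton_eq_iff)
  qed (rule b(2))
qed

text \<open>Grounding a further vertex changes the Green function by a rank one update: the difference
  of both sides is harmonic off \<open>insert u Q\<close> and vanishes there.\<close>

lemma green_insert:
  assumes Q: "Q \<subseteq> V" "Q \<noteq> {}" and u: "u \<in> V" "u \<notin> Q" and wx: "w \<in> V" "x \<in> V"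
  shows "real (card (rooted_forests Q)) * real (green (insert u Q) w x) =
    real (green Q u u) * real (green Q w x) - real (green Q w u) * real (green Q u x)"
proof -
  define D where "D x = real (card (rooted_forests Q)) * real (green (insert u Q) w x) -
    (real (green Q u u) * real (green Q w x) - real (green Q w u) * real (green Q u x))" for x
  have zero: "D y = 0" if "y \<in> insert u Q" for y
    using that by (auto simp: D_def green_root_right)
  have "laplacian D y = 0" if "y \<notin> insert u Q" for y
    using that u wx unfolding D_def laplacian_diff laplacian_scale
    by (simp add: laplacian_green green_diag)
  with zero have "D y = 0 \<or> laplacian D y = 0" for y
    by blast
  moreover obtain q where "q \<in> V" "D q = 0"
    using Q zero by blast
  ultimately have "D x = 0"
    using harmonic_off_zeros_imp_zero wx(2) by blast
  then show ?thesis
    by (simp add: D_def)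
qed

lemma spanning_trees_times_away_count:
  assumes e: "e \<in> E" and q: "q \<in> V"
  shows "real (card spanning_trees) * real (away_count q e) =
    real (green {q} (tail e) (tail e)) * real (green {q} (head e) (head e)) -
    (real (green {q} (tail e) (head e)))\<^sup>2"
proof (cases "head e = q")
  case True
  have "conn F (tail e) q" if "e \<in> F" for F
    using conn_tail_head[OF that e] True by simp
  then have "away_count q e = 0"
    by (auto simp: away_count_def card_eq_0_iff)
  then show ?thesis
    using True by (simp add: green_root_right)
next
  case False
  note verts = tail_in_verts[OF e] head_in_verts[OF e]
  show ?thesis
    using green_insert[of "{q}" "head e" "tail e" "tail e"] q verts False
      green_commute[OF q verts] away_count_eq_green[OF e q False]
    by (simp add: rooted_forests_singleton power2_eq_square mult.commute)
qed

lemma card_spanning_trees_eq_sum: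
  assumes q: "q \<in> V" and v: "v \<in> V" "v \<noteq> q"
  shows "real (card spanning_trees) = (\<Sum>e\<in>incident v.
    (real (cut_count e) + real (green {q} v v) - real (green {q} (other e v) (other e v))) / 2)"
proof -
  have "real (card spanning_trees) = laplacian (\<lambda>x. real (green {q} v x)) v"
    using laplacian_green[OF v(1), of v "{q}"] q v(2) by (simp add: rooted_forests_singleton)
  also have "\<dots> = (\<Sum>e\<in>incident v.
      (real (cut_count e) + real (green {q} v v) - real (green {q} (other e v) (other e v))) / 2)"
    unfolding laplacian_def
  proof (rule sum.cong[OF refl])
    fix e assume "e \<in> incident v"
    then have e: "e \<in> E" "v = tail e \<or> v = head e"
      using ends_tail_head[of e] by (auto simp: incident_def)
    then show "real (green {q} v v) - real (green {q} v (other e v)) =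
        (real (cut_count e) + real (green {q} v v) - real (green {q} (other e v) (other e v))) / 2"
      using cut_count_eq_green[OF e(1) q] green_commute[OF q tail_in_verts[OF e(1)] head_in_verts[OF e(1)]]
      by auto
  qed
  finally show ?thesis .
qed

lemma spanning_trees_times_two_forests:
  assumes q: "q \<in> V"
  shows "real (card spanning_trees) * real (card (two_forests G)) =
    (\<Sum>e\<in>E. (real (cut_count e))\<^sup>2 / 4 +
      3 / 4 * (real (green {q} (tail e) (tail e)) - real (green {q} (head e) (head e)))\<^sup>2)"
proof -
  let ?k = "real (card spanning_trees)" and ?h = "\<lambda>v. real (green {q} v v)"
    and ?R = "\<lambda>e. real (cut_count e)" and ?N = "\<lambda>e. real (away_count q e)"
  let ?flow = "\<lambda>v e. ?h v * ((?R e + ?h v - ?h (other e v)) / 2)"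
  have "?h v * ?k = (\<Sum>e\<in>incident v. ?flow v e)" if "v \<in> V" for v
    using card_spanning_trees_eq_sum[OF q that]
    by (cases "v = q") (simp_all add: green_root_right sum_distrib_left)
  then have "(\<Sum>v\<in>V. ?h v * ?k) = (\<Sum>e\<in>E. ?flow (tail e) e + ?flow (head e) e)"
    using sum_incident[of ?flow] by simp
  moreover have "real (card (two_forests G)) = (\<Sum>v\<in>V. ?h v) - (\<Sum>e\<in>E. ?N e)"
    using card_two_forests_eq_sum[OF q] by (simp add: algebra_simps flip: of_nat_sum of_nat_add)
  ultimately have "?k * real (card (two_forests G)) =
      (\<Sum>e\<in>E. ?flow (tail e) e + ?flow (head e) e - ?k * ?N e)"
    by (simp add: right_diff_distrib sum_distrib_left sum_subtractf mult.commute[of ?k])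
  also have "\<dots> = (\<Sum>e\<in>E. (?R e)\<^sup>2 / 4 + 3 / 4 * (?h (tail e) - ?h (head e))\<^sup>2)"
    by (intro sum.cong refl) (simp add: spanning_trees_times_away_count[OF _ q]
        cut_count_eq_green[OF _ q] field_simps power2_eq_square)
  finally show ?thesis .
qed

lemma sum_cut_count_squared_le:
  assumes "V \<noteq> {}"
  shows "(\<Sum>e\<in>E. (real (cut_count e))\<^sup>2) \<le>
    4 * real (card spanning_trees) * real (card (two_forests G))"
proof -
  obtain q where "q \<in> V"
    using assms by blast
  then show ?thesis
    by (simp add: mult.assoc spanning_trees_times_two_forests sum_distrib_left sum_mono)
qed

lemma card_spanning_trees_bound:
  assumes "V \<noteq> {}"
  shows "(real (card V) - 1)\<^sup>2 * real (card spanning_trees) \<le>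
    4 * real (card E) * real (card (two_forests G))"
proof -
  let ?k = "real (card spanning_trees)"
  have "?k * ((real (card V) - 1)\<^sup>2 * ?k) = (\<Sum>e\<in>E. real (cut_count e))\<^sup>2"
    by (simp add: sum_cut_count[OF assms] power2_eq_square)
  also have "\<dots> \<le> (\<Sum>e\<in>E. (real (cut_count e))\<^sup>2) * real (card E)"
    by (rule sum_squared_le_sum_of_squares)
  also have "\<dots> \<le> 4 * ?k * real (card (two_forests G)) * real (card E)"
    using sum_cut_count_squared_le[OF assms] by (intro mult_right_mono) auto
  also have "\<dots> = ?k * (4 * real (card E) * real (card (two_forests G)))"
    by simp
  finally show ?thesis
    using spanning_trees_nonempty finite_spanning_trees by (simp add: card_gt_0_iff)
qed

lemma two_forests_nonempty:
  assumes "card V \<ge> 2"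
  shows "two_forests G \<noteq> {}"
proof
  assume "two_forests G = {}"
  moreover have "V \<noteq> {}"
    using assms by auto
  ultimately have "(real (card V) - 1)\<^sup>2 * real (card spanning_trees) \<le> 0"
    using card_spanning_trees_bound by simp
  then show False
    using assms spanning_trees_nonempty finite_spanning_trees by (simp add: mult_le_0_iff)
qed

lemma expectation_card_cut_set:
  assumes "card V \<ge> 2"
  shows "measure_pmf.expectation (pmf_of_set (two_forests G)) (\<lambda>F. real (card (cut_set G F))) =
    (real (card V) - 1) * real (card spanning_trees) / real (card (two_forests G))"
proof -
  have "V \<noteq> {}"
    using assms by auto
  then have "(\<Sum>F\<in>two_forests G. real (card (cut_set G F))) =
      (real (card V) - 1) * real (card spanning_trees)"
    using sum_card_cut_set sum_cut_count by (simp flip: of_nat_sum)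
  then show ?thesis
    using integral_pmf_of_set[OF two_forests_nonempty[OF assms] finite_two_forests] by simp
qed

end

theorem theorem6p2:
  fixes G :: "('v, 'e) multigraph"
  assumes "finite_multigraph G"
    and "connected_graph G"
    and "card (verts G) \<ge> 2"
  shows "measure_pmf.expectation (pmf_of_set (two_forests G)) (\<lambda>F. real (card (cut_set G F)))
    \<le> 2 * avg_deg G * (1 + 1 / (real (card (verts G)) - 1))"
proof -
  interpret connected_multigraph G
    using assms(1,2) by unfold_locales
  let ?n = "real (card V)" and ?m = "real (card E)"
    and ?k = "real (card spanning_trees)" and ?p = "real (card (two_forests G))"
  have n: "?n \<ge> 2" and "V \<noteq> {}"
    using assms(3) by auto
  have p: "?p > 0"
    using two_forests_nonempty[OF assms(3)] finite_two_forests by (simp add: card_gt_0_iff)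
  have "measure_pmf.expectation (pmf_of_set (two_forests G)) (\<lambda>F. real (card (cut_set G F))) =
      (?n - 1) * ?k / ?p"
    by (rule expectation_card_cut_set[OF assms(3)])
  also have "\<dots> \<le> 4 * ?m / (?n - 1)"
    using card_spanning_trees_bound[OF \<open>V \<noteq> {}\<close>] n p
    by (simp add: divide_simps power2_eq_square mult_ac)
  also have "\<dots> = 2 * (2 * ?m / ?n) * (1 + 1 / (?n - 1))"
    using n by (simp add: field_simps)
  finally show ?thesis
    by (simp only: avg_deg_eq[OF assms(1)])
qed

end
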